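(* Let $\varphi$ be Euler's function and let $\varphi(\mathbb{N}) = \{ n \in \mathbb{N} \mid \exists\, x \in \mathbb{N} : \varphi(x)=n \}$. Then the minimal set of $\varphi(\mathbb{N})$ is $$M(\varphi(\mathbb{N})) = \{ 1, 2, 4, 6, 8, 30, 70, 500, 900, 990, 5590, 9550, 555555555550 \}.$$
   Context: $\mathbb{N}=\{1,2,3,\ldots\}$ denotes the positive integers. Euler's function $\varphi(n)$ is the number of positive integers not exceeding $n$ that are relatively prime to $n$. Each positive integer is identified with its usual base-10 digit string (without leading zeros). For positive integers $x,y$ write $x \triangleleft y$ if the digit string of $x$ is a subsequence (in order, not necessarily contiguous) of the digit string of $y$, i.e. either $x=y$ or $x$ is obtained from $y$ by deleting some digits of $y$ (for example $514 \triangleleft 352148$). For a set $S\subset\mathbb{N}$, the minimal set of $S$ is $$M(S) := \{ s\in S \mid \{ n\in S : n<s,\ n\triangleleft s\}=\varnothing \}.$$ The last listed element, $555555555550$, consists of eleven digits $5$ followed by one digit $0$. *)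

theory Defs
  imports "HOL-Number_Theory.Totient" "HOL-Library.Sublist"
begin

(* Base-10 digits, most significant first. There is no leading zero for n > 0; the value [0] at
   n = 0 plays no role for sets of positive integers. *)
fun decimal_digits :: "nat \<Rightarrow> nat list" where
  "decimal_digits n = (if n < 10 then [n] else decimal_digits (n div 10) @ [n mod 10])"

(* As an unconditional rewrite rule the recursive equation makes the simplifier loop. *)
declare decimal_digits.simps [simp del]

definition digit_subseq :: "nat \<Rightarrow> nat \<Rightarrow> bool"  (infix \<open>\<triangleleft>\<close> 50) where
  "x \<triangleleft> y \<longleftrightarrow> subseq (decimal_digits x) (decimal_digits y)"

definition minimal_set :: "nat set \<Rightarrow> nat set" where
  "minimal_set S = {s \<in> S. {n \<in> S. n < s \<and> n \<triangleleft> s} = {}}"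

definition totient_values :: "nat set" where
  "totient_values = {n. n > 0 \<and> (\<exists>x>0. totient x = n)}"

end

theory Submission
  imports Defs "HOL-Number_Theory.Pocklington" "HOL-Number_Theory.Mod_Exp"
begin

text \<open>
  Every totient value above 1 is even, so a digit string avoiding 1, 2, 4, 6, 8 as subsequences ends
  in 0; avoiding also 30, 70, 500, 900, 990, 5590 and 9550 leaves only the strings \<open>5\<dots>50\<close>,
  90, 590, 950 and 5950. Those with fewer than eleven digits 5 are congruent to 2 modulo 4, hence
  a totient value \<open>n\<close> among them would be of the form \<open>p ^ m * (p - 1)\<close> with \<open>p\<close> prime. Here
  \<open>m > 0\<close>, as \<open>n + 1\<close> has a small factor, and reducing modulo squares of divisors of \<open>p - 1\<close> leaves few values of \<open>p\<close> small enough.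
\<close>

subsection \<open>Decimal digits\<close>

lemma decimal_digits_less [simp]: "n < 10 \<Longrightarrow> decimal_digits n = [n]"
  by (subst decimal_digits.simps) simp

lemma decimal_digits_ge [simp]:
  "n \<ge> 10 \<Longrightarrow> decimal_digits n = decimal_digits (n div 10) @ [n mod 10]"
  by (subst decimal_digits.simps) simp

text \<open>A left inverse of \<open>decimal_digits\<close>, used to turn statements about digit
  strings into statements about numbers.\<close>

primrec digits_value :: "nat list \<Rightarrow> nat" where
  "digits_value [] = 0"
| "digits_value (d # ds) = d * 10 ^ length ds + digits_value ds"

lemma digits_value_snoc: "digits_value (ds @ [d]) = 10 * digits_value ds + d"
  by (induction ds) (auto simp: algebra_simps)

lemma digits_value_replicate: "digits_value (replicate k d) = d * (10 ^ k - 1) div 9"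
proof -
  have "9 * digits_value (replicate k d) + d = d * 10 ^ k"
    by (induction k) (auto simp: algebra_simps)
  then have "d * (10 ^ k - 1) = 9 * digits_value (replicate k d)" by (simp add: diff_mult_distrib2)
  then show ?thesis by simp
qed

lemma digits_value_decimal_digits [simp]: "digits_value (decimal_digits n) = n"
proof (induction n rule: less_induct)
  case (less n)
  then show ?case by (cases "n < 10") (auto simp: digits_value_snoc)
qed

lemma decimal_digits_nonempty [simp]: "decimal_digits n \<noteq> []"
  by (cases "n < 10") auto

lemma last_decimal_digits: "last (decimal_digits n) = n mod 10"
  by (cases "n < 10") auto

lemma hd_decimal_digits: "n > 0 \<Longrightarrow> hd (decimal_digits n) \<noteq> 0"
proof (induction n rule: less_induct)
  case (less n)
  then show ?case by (cases "n < 10") (auto simp: hd_append)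
qed

lemma set_decimal_digits: "set (decimal_digits n) \<subseteq> {..<10}"
proof (induction n rule: less_induct)
  case (less n)
  then show ?case
  proof (cases "n < 10")
    case False
    then show ?thesis using less[of "n div 10"] by auto
  qed auto
qed

text \<open>Deleting digits leaves no more digits to the right of a kept one, so no place value
  grows.\<close>

lemma digits_value_mono: "subseq xs ys \<Longrightarrow> digits_value xs \<le> digits_value ys"
proof (induction rule: list_emb.induct)
  case (list_emb_Cons2 x y xs ys)
  then have "length xs \<le> length ys" by (auto dest: list_emb_length)
  then have "(10::nat) ^ length xs \<le> 10 ^ length ys" by (intro power_increasing) auto
  with list_emb_Cons2 show ?case by (auto intro!: add_mono mult_le_mono)
qed auto

lemma digit_subseq_imp_le: "x \<triangleleft> y \<Longrightarrow> x \<le> y"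
  unfolding digit_subseq_def by (metis digits_value_decimal_digits digits_value_mono)

lemma digit_subseq_trans: "x \<triangleleft> y \<Longrightarrow> y \<triangleleft> z \<Longrightarrow> x \<triangleleft> z"
  unfolding digit_subseq_def by (rule subseq_order.trans)

text \<open>Since \<open>t \<triangleleft> s\<close> forces \<open>t \<le> s\<close>, a minimal
  \<open>s\<close> equals the element of \<open>L\<close> below it. Conversely, a smaller
  \<open>n \<triangleleft> s\<close> with \<open>s\<close> in \<open>L\<close> would lie above some
  \<open>t\<close> in \<open>L\<close>; the antichain property gives \<open>t = s\<close>, against
  \<open>t \<le> n < s\<close>.\<close>

lemma minimal_set_eqI:
  assumes sub: "L \<subseteq> S"
    and minor: "\<And>n. n \<in> S \<Longrightarrow> \<exists>t\<in>L. t \<triangleleft> n"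
    and anti: "\<And>s t. s \<in> L \<Longrightarrow> t \<in> L \<Longrightarrow> t \<triangleleft> s \<Longrightarrow> t = s"
  shows "minimal_set S = L"
proof (intro equalityI subsetI)
  fix s assume s: "s \<in> minimal_set S"
  then obtain t where t: "t \<in> L" "t \<triangleleft> s" using minor by (auto simp: minimal_set_def)
  with s sub have "\<not> t < s" by (auto simp: minimal_set_def)
  with t digit_subseq_imp_le[of t s] show "s \<in> L" by auto
next
  fix s assume s: "s \<in> L"
  have False if n: "n \<in> S" "n < s" "n \<triangleleft> s" for n
  proof -
    obtain t where t: "t \<in> L" "t \<triangleleft> n" using minor n by blast
    then have "t = s" using anti s digit_subseq_trans n by blast
    with t n show False using digit_subseq_imp_le by fastforce
  qed
  with s sub show "s \<in> minimal_set S" by (auto simp: minimal_set_def)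
qed

subsection \<open>Totients that are 2 modulo 4\<close>

text \<open>For an odd prime \<open>p\<close> dividing \<open>x\<close>, the even factor
  \<open>p - 1\<close> uses up the only factor 2, so the part of \<open>x\<close> prime to
  \<open>p\<close> has odd totient and is 1 or 2. With no such prime, \<open>x\<close> is a power of
  2 and \<open>p = 2\<close> serves.\<close>

lemma totient_mod_4_eq_2:
  assumes "totient x mod 4 = 2"
  obtains p m where "prime p" "totient x = p ^ m * (p - 1)"
proof (cases "\<exists>p. prime p \<and> odd p \<and> p dvd x")
  case True
  then obtain p where p: "prime p" "odd p" "p dvd x" by blast
  have x: "x \<noteq> 0" using assms by (cases x) auto
  obtain k y where ky: "x = p ^ Suc k * y" "\<not> p dvd y"
  proof -
    have "multiplicity p x > 0" using p x by (simp add: prime_multiplicity_gt_zero_iff)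
    then show ?thesis
      using multiplicity_decompose'[of x p] p x that[of "multiplicity p x - 1"]
      by (metis Suc_pred' not_prime_unit)
  qed
  have "coprime (p ^ Suc k) y" using ky p by (simp add: prime_imp_coprime)
  then have tot: "totient x = p ^ k * (p - 1) * totient y"
    using ky(1) p(1) totient_prime_power_Suc totient_mult_coprime by metis
  have "odd (totient y)"
  proof
    assume "even (totient y)"
    moreover have "even (p - 1)" using p by simp
    ultimately have "2 * 2 dvd totient x" unfolding tot by (intro mult_dvd_mono dvd_mult) auto
    then show False using assms by auto
  qed
  then have "y \<le> 2" using totient_even[of y] by force
  moreover have "y \<noteq> 0" using x ky by auto
  ultimately have "y = 1 \<or> y = 2" by auto
  then have "totient y = 1" by auto
  with tot p that show ?thesis by auto
next
  case False
  have x: "x \<noteq> 0" using assms by (cases x) auto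
  obtain k y where ky: "x = 2 ^ k * y" "odd y"
    using multiplicity_decompose'[of x 2] x by (metis not_prime_unit two_is_prime_nat gr0_conv_Suc neq0_conv)
  have "y = 1"
  proof (rule ccontr)
    assume "y \<noteq> 1"
    then obtain p where "prime p" "p dvd y" using prime_factor_nat by blast
    with ky False show False by (metis dvd_mult dvd_trans)
  qed
  then have xk: "x = 2 ^ k" using ky by simp
  with assms have "k \<noteq> 0" by (intro notI) simp
  then have "totient x = 2 ^ (k - 1) * (2 - 1)"
    using xk totient_prime_power two_is_prime_nat by blast
  then show ?thesis using that two_is_prime_nat by blast
qed

text \<open>The power is 1 modulo \<open>d\<close>, and the factor \<open>u\<close> contributes a
  second \<open>d\<close>. With \<open>u = p - 1\<close> this reads off \<open>u\<close> modulo
  \<open>d\<^sup>2\<close> from the totient.\<close>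

lemma cong_mult_power_Suc:
  fixes d u :: nat
  assumes "d dvd u"
  shows "[(u + 1) ^ m * u = u] (mod d\<^sup>2)"
proof -
  have "[(u + 1) ^ m = 1 ^ m] (mod d)"
    using assms by (intro cong_pow) (simp add: cong_altdef_nat)
  then have "[(u + 1) ^ m * u = 1 * u] (mod (d * u))"
    by (simp add: cong_scalar_right cong_def mult.commute)
  moreover have "d\<^sup>2 dvd d * u" using assms by (simp add: power2_eq_square)
  ultimately show ?thesis using cong_dvd_modulus_nat by simp
qed

text \<open>Here \<open>u = p - 1\<close>. The proper divisor \<open>d\<close> of
  \<open>n + 1\<close> excludes exponent 0. As 4 does not divide \<open>n\<close>, \<open>p\<close>
  is not 5, so the factor 5 of \<open>n\<close> divides \<open>u\<close>; then
  \<open>10 dvd u\<close>, and \<open>u\<close> has the last two digits of \<open>n\<close>.\<close>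

lemma totient_mod_20_eq_10:
  assumes tot: "totient x = n" and n: "n mod 20 = 10"
    and d: "d dvd n + 1" "d \<noteq> 1" "d < n + 1"
  obtains u m where "n = (u + 1) ^ Suc m * u" "10 dvd u" "u mod 100 = n mod 100" "u > 0"
proof -
  have "n mod 4 = 2" "n mod 5 = 0" using n by presburger+
  obtain p k where p: "prime p" "n = p ^ k * (p - 1)"
    using totient_mod_4_eq_2 \<open>n mod 4 = 2\<close> tot by metis
  define u where "u = p - 1"
  have pu: "p = u + 1" and "u > 0" using prime_gt_1_nat[OF p(1)] by (auto simp: u_def)
  have nu: "n = p ^ k * u" using p by (simp add: u_def)
  have "k \<noteq> 0"
  proof
    assume "k = 0"
    then have "n + 1 = p" using nu pu by simp
    then show False using p d by (auto simp: prime_nat_iff)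
  qed
  then obtain m where k: "k = Suc m" using not0_implies_Suc by blast
  have "\<not> 5 dvd p"
  proof
    assume "5 dvd p"
    then have "p = 5" using p primes_dvd_imp_eq[of 5 p] by simp
    then have "4 dvd n" using nu pu by simp
    then show False using \<open>n mod 4 = 2\<close> by auto
  qed
  have "5 dvd p ^ k * u" using nu \<open>n mod 5 = 0\<close> by auto
  then have "5 dvd u"
    using \<open>\<not> 5 dvd p\<close> prime_dvd_mult_iff[of 5 "p ^ k" u] prime_dvd_power[of 5 p k] by auto
  have "p \<noteq> 2" using \<open>5 dvd u\<close> pu by auto
  then have "2 dvd u" using p prime_odd_nat[of p] prime_ge_2_nat[of p] pu by auto
  with \<open>5 dvd u\<close> have "10 dvd u" by presburger
  then have "[n = u] (mod 10\<^sup>2)" using cong_mult_power_Suc[of 10 u k] nu pu by simp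
  with \<open>10 dvd u\<close> \<open>u > 0\<close> nu pu k that show ?thesis by (auto simp: cong_def)
qed

lemma mult_Suc_le_power: "(u + 1) * u \<le> (u + 1) ^ Suc m * (u::nat)"
  by (intro mult_le_mono self_le_power) auto

section \<open>Exclusion of the exceptional digit strings\<close>

text \<open>The positive exponent gives \<open>(u + 1) * u \<le> n\<close>, which the last two
  digits of \<open>u\<close> almost always contradict.\<close>

lemma not_totient_small:
  assumes "n \<in> {90, 590, 950, 5950}"
  shows "totient x \<noteq> n"
proof
  assume tot: "totient x = n"
  \<comment> \<open>The factorisations are 91 = 7 * 13, 591 = 3 * 197, 951 = 3 * 317 and 5951 = 11 *
    541.\<close>
  have "\<exists>d\<in>{3, 7, 11}. d dvd n + 1 \<and> d < n + 1"
    using assms by (elim insertE emptyE) simp_all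
  then obtain d where "d \<in> {3, 7, 11}" and d: "d dvd n + 1" "d < n + 1" by blast
  then have d1: "d \<noteq> 1" by auto
  have "n mod 20 = 10" using assms by (elim insertE emptyE) simp_all
  then obtain u m where u: "n = (u + 1) ^ Suc m * u" "u mod 100 = n mod 100"
    using totient_mod_20_eq_10[OF tot _ d(1) d1 d(2)] by metis
  have bound: "(u + 1) * u \<le> n" using mult_Suc_le_power u by metis
  show False
  proof (cases "n \<in> {90, 590}")
    case True
    then have "u mod 100 = 90" using u(2) by auto
    then have "u \<ge> 90" using mod_less_eq_dividend[of u 100] by simp
    then have "(90 + 1) * 90 \<le> (u + 1) * u" by (intro mult_le_mono) auto
    with bound True show False by auto
  next
    case False
    then have "u mod 100 = 50" using u(2) assms by auto
    then have "u = 100 * (u div 100) + 50" by (metis mult_div_mod_eq)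
    \<comment> \<open>The second option is too large for 5950; the first would make 2550 divide 950
      or 5950.\<close>
    then have "u = 50 \<or> u \<ge> 150" by (cases "u div 100") auto
    then show False
    proof
      assume "u \<ge> 150"
      then have "(150 + 1) * 150 \<le> (u + 1) * u" by (intro mult_le_mono) auto
      with bound assms show False by auto
    next
      assume [simp]: "u = 50"
      have "50 * 51 dvd n" using u(1) by simp
      then show False using assms by (elim insertE emptyE) simp_all
    qed
  qed
qed

text \<open>The congruence modulo 100 gives \<open>50 dvd u\<close>, which in turn fixes
  \<open>u\<close> modulo 2500. Size then bounds both the exponent and \<open>u\<close>, leaving
  finitely many products to compare.\<close>

lemma not_totient_fives:
  assumes "n \<in> {50, 550, 5550, 55550, 555550, 5555550, 55555550, 555555550, 5555555550, 55555555550}"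
  shows "totient x \<noteq> n"
proof
  assume tot: "totient x = n"
  \<comment> \<open>With \<open>k\<close> digits 5, \<open>n + 1\<close> is divisible by 3 for
    \<open>k\<close> = 1, 4, 7, 10, by 7 for \<open>k\<close> = 3, 9, and by 19, 31, 773, 7417 for
    \<open>k\<close> = 2, 5, 6, 8 respectively.\<close>
  have "\<exists>d\<in>{3, 7, 19, 31, 773, 7417}. d dvd n + 1 \<and> d < n + 1"
    using assms by (elim insertE emptyE) simp_all
  then obtain d where "d \<in> {3, 7, 19, 31, 773, 7417}" and d: "d dvd n + 1" "d < n + 1" by blast
  then have d1: "d \<noteq> 1" by auto
  have "n mod 20 = 10" using assms by (elim insertE emptyE) simp_all
  then obtain u m where u: "n = (u + 1) ^ Suc m * u" "u mod 100 = n mod 100"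
    using totient_mod_20_eq_10[OF tot _ d(1) d1 d(2)] by metis
  have bound: "(u + 1) * u \<le> n" using mult_Suc_le_power u by metis
  have "u mod 100 = 50" using u(2) assms by (elim insertE emptyE) simp_all
  then have "u = 50 * (2 * (u div 100) + 1)" using mult_div_mod_eq[of 100 u] by simp
  then have "50 dvd u" by (rule dvdI)
  then have "[n = u] (mod 50\<^sup>2)" unfolding u(1) by (rule cong_mult_power_Suc)
  then have cong: "u mod 2500 = n mod 2500" by (simp add: cong_def)
  have "u \<ge> 50" using \<open>u mod 100 = 50\<close> mod_less_eq_dividend[of u 100] by simp
  then have "(50 + 1) * 50 \<le> (u + 1) * u" by (intro mult_le_mono) auto
  then have "n \<notin> {50, 550}" using bound by auto
  then have "u mod 2500 = 550" using cong assms by auto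
  then have "u = 2500 * (u div 2500) + 550" by (metis mult_div_mod_eq)
  then obtain i where ui: "u = 2500 * i + 550" ..
  have n_le: "n \<le> 55555555550" using assms by auto
  have "(550 + 1) * 550 \<le> (u + 1) * u" by (intro mult_le_mono) (auto simp: ui)
  then have n_in: "n \<in> {555550, 5555550, 55555550, 555555550, 5555555550, 55555555550}"
    using bound assms by (elim insertE emptyE) simp_all
  have "m < 2"
  proof (rule ccontr)
    assume "\<not> m < 2"
    then have "(551::nat) ^ 3 * 550 \<le> 551 ^ Suc m * 550"
      by (intro mult_le_mono power_increasing) auto
    also have "\<dots> \<le> (u + 1) ^ Suc m * u" by (intro mult_le_mono power_mono) (auto simp: ui)
    also have "\<dots> \<le> 55555555550" using n_le u(1) by simp
    finally show False by simp
  qed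
  then consider "m = 0" | "m = 1" by linarith
  then show False
  proof cases
    case 1
    then have n_eq: "n = (2500 * i + 551) * (2500 * i + 550)" using u(1) ui by simp
    \<comment> \<open>For \<open>i = 95\<close>, \<open>u = 238050\<close>, and
      \<open>(u + 1) * u\<close> already exceeds the largest \<open>n\<close>.\<close>
    have "i < 95"
    proof (rule ccontr)
      assume "\<not> i < 95"
      then have "(238050 + 1) * 238050 \<le> (u + 1) * u" by (intro mult_le_mono) (auto simp: ui)
      with bound n_le show False by simp
    qed
    \<comment> \<open>Modulo 25000 the product depends only on the last digit \<open>s\<close> of
      \<open>i\<close>. This forces \<open>s = 1\<close> and leaves ten values of
      \<open>t\<close>.\<close>
    define t s where "t = i div 10" and "s = i mod 10"
    have its: "i = 10 * t + s" by (simp add: t_def s_def)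
    have "n = 25000 * (250 * i\<^sup>2 + 110 * i + t + 12) + (2500 * s + 3050)"
      unfolding n_eq by (simp add: its power2_eq_square algebra_simps)
    then have "n mod 25000 = (2500 * s + 3050) mod 25000" by (metis mod_mult_self4)
    moreover have "n mod 25000 = 5550" using n_in by (elim insertE emptyE) simp_all
    ultimately have s_mod: "(2500 * s + 3050) mod 25000 = 5550" by simp
    have "s < 10" by (simp add: s_def)
    then have "s \<in> {0,1,2,3,4,5,6,7,8,9}" by auto
    then have "s = 1" using s_mod by (elim insertE emptyE) simp_all
    have "t \<in> {0,1,2,3,4,5,6,7,8,9}" using \<open>i < 95\<close> its by auto
    then have "n \<notin> {555550, 5555550, 55555550, 555555550, 5555555550, 55555555550}"
      unfolding n_eq its \<open>s = 1\<close> by (elim insertE emptyE) simp_all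
    with n_in show False by contradiction
  next
    case 2
    then have "n = (u + 1) * (u + 1) * u" using u(1) by simp
    moreover have "u + 1 = 2500 * i + 551" using ui by simp
    ultimately have n_eq: "n = (2500 * i + 551) * (2500 * i + 551) * (2500 * i + 550)"
      using ui by (simp only:)
    have "i < 2"
    proof (rule ccontr)
      assume "\<not> i < 2"
      then have "5551 * 5551 * 5550 \<le> n" unfolding n_eq by (intro mult_le_mono) auto
      with n_le show False by simp
    qed
    then consider "i = 0" | "i = 1" by linarith
    then show False using n_in by cases (simp_all add: n_eq)
  qed
qed

subsection \<open>Totient values\<close>

text \<open>The range is a list so that for a concrete \<open>k\<close> it unfolds into finitely
  many divisibility checks.\<close>

lemma prime_nat_trial_division:
  fixes n k :: nat
  assumes "n > 1" "n < k\<^sup>2" "\<forall>d\<in>set [2..<k]. \<not> d dvd n"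
  shows "prime n"
  unfolding prime_divisor_sqrt
proof (intro conjI allI impI)
  fix d assume d: "d dvd n \<and> d\<^sup>2 \<le> n"
  then have "d\<^sup>2 < k\<^sup>2" using assms(2) by linarith
  then have "d < k" by (rule power_less_imp_less_base) simp
  moreover have "d \<noteq> 0" using d assms(1) by (intro notI) simp
  ultimately show "d = 1" using d assms(3) by (cases "d = 1") auto
qed (use assms(1) in simp)

text \<open>
  Pocklington's criterion with \<open>555555555550 = (2 * 5 * 5 * 21649) * 513239\<close>. Powers are rewritten to
  \<open>mod_exp\<close>, which the simplifier computes by repeated squaring.
\<close>

lemma prime_555555555551: "prime (555555555551::nat)"
\<comment> \<open>Every prime divisor is 1 modulo the factored part 1082450, whose square exceeds
  555555555551.\<close>
proof (rule pocklington_primefact[where a = 17 and q = 1082450 and r = 513239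
      and b = 385072235695 and ps = "[2, 5, 5, 21649]"])
  show "17 ^ 513239 mod 555555555551 = (385072235695::nat)"
    by (subst mod_exp_def[symmetric]) simp
  show "385072235695 ^ 1082450 mod 555555555551 = (1::nat)"
    by (subst mod_exp_def[symmetric]) simp
  have "prime (2::nat)" "prime (5::nat)" by simp_all
  \<comment> \<open>148 is large enough, as its square is 21904.\<close>
  moreover have "prime (21649::nat)"
    by (rule prime_nat_trial_division[of _ 148]; simp add: upt_conv_Cons del: set_upt)
  moreover have "coprime (mod_exp 385072235695 (1082450 div p) 555555555551 - 1) (555555555551::nat)"
    if "p = 2 \<or> p = 5 \<or> p = 21649" for p
    using that by (elim disjE; hypsubst; simp add: coprime_iff_gcd_eq_1 gcd_non_0_nat)
  ultimately show "list_all (\<lambda>p. prime p \<and>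
      coprime (385072235695 ^ (1082450 div p) mod 555555555551 - 1) (555555555551::nat)) [2, 5, 5, 21649]"
    by (simp only: list.pred_inject mod_exp_def simp_thms)
qed simp_all

text \<open>Positivity of \<open>x\<close> follows from that of \<open>n\<close>, as
  \<open>totient 0 = 0\<close>.\<close>

lemma totient_valuesI: "n > 0 \<Longrightarrow> totient x = n \<Longrightarrow> n \<in> totient_values"
  by (auto simp: totient_values_def intro!: exI[of _ x] gr0I)

lemma prime_totient_value: "prime p \<Longrightarrow> p - 1 \<in> totient_values"
  using prime_gt_1_nat[of p] by (intro totient_valuesI[of _ p] totient_prime) auto

text \<open>Apart from 1, 8, 500 and 900, the witness is the prime one above the value. Since 9, 501
  and 901 are composite, 8, 500 and 900 come from \<open>2 ^ 4\<close>, \<open>5 ^ 4\<close> and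
  \<open>7 * 151\<close>.\<close>

lemma candidates_totient_values:
  "{1, 2, 4, 6, 8, 30, 70, 500, 900, 990, 5590, 9550, 555555555550} \<subseteq> totient_values"
proof -
  have "prime (31::nat)" "prime (71::nat)" by simp_all
  moreover have "prime (991::nat)" "prime (5591::nat)" "prime (9551::nat)"
    by (rule prime_nat_trial_division[of _ 98]; simp add: upt_conv_Cons del: set_upt)+
  ultimately have "31 - 1 \<in> totient_values" "71 - 1 \<in> totient_values" "991 - 1 \<in> totient_values"
    "5591 - 1 \<in> totient_values" "9551 - 1 \<in> totient_values" "555555555551 - 1 \<in> totient_values"
    using prime_555555555551 by (simp_all only: prime_totient_value)
  moreover have "500 \<in> totient_values"
    by (rule totient_valuesI[of _ "5 ^ 4"]) (simp, subst totient_prime_power, simp_all)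
  moreover have "900 \<in> totient_values"
  proof (rule totient_valuesI)
    have "prime (151::nat)" by simp
    then have "totient 151 = 150" using totient_prime by fastforce
    moreover have "coprime (7::nat) 151" by (simp add: coprime_iff_gcd_eq_1 gcd_non_0_nat)
    \<comment> \<open>The product must stay unevaluated for multiplicativity to apply.\<close>
    ultimately show "totient (7 * 151) = 900" by (simp add: totient_mult_coprime del: numeral_times_numeral)
  qed simp
  moreover have "8 \<in> totient_values"
    by (rule totient_valuesI[of _ "2 ^ 4"]) (simp, subst totient_prime_power, simp_all)
  moreover have "1 \<in> totient_values" "2 \<in> totient_values" "4 \<in> totient_values" "6 \<in> totient_values"
    using totient_valuesI[of _ 1] totient_valuesI[of _ 3] totient_valuesI[of _ 5]
      totient_valuesI[of _ 7] by auto
  ultimately show ?thesis by simp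
qed

lemma totient_value_even: "n \<in> totient_values \<Longrightarrow> n \<noteq> 1 \<Longrightarrow> even n"
proof -
  assume "n \<in> totient_values" "n \<noteq> 1"
  then obtain x where x: "x > 0" "totient x = n" by (auto simp: totient_values_def)
  have "x \<noteq> 1" "x \<noteq> 2" using x \<open>n \<noteq> 1\<close> by auto
  with x have "x > 2" by auto
  with x totient_even show "even n" by auto
qed

subsection \<open>The minorising set\<close>

lemma subseq_replicate: "k \<le> n \<Longrightarrow> subseq (replicate k x @ zs) (replicate n x @ zs)"
  using subseq_drop_many[of "replicate k x @ zs" _ "replicate (n - k) x"]
  by (metis append.assoc replicate_add le_add_diff_inverse2 subseq_order.refl)

text \<open>The combinatorial core: each string of the list removes one freedom from
  \<open>ds\<close>, and the numbers in the last two hypotheses are exactly what survives.\<close>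

lemma minorising_digit_string:
  assumes ds: "ds \<noteq> []" "hd ds \<noteq> 0" "set ds \<subseteq> {..<10}" "even (last ds)"
    and nontotient: "digits_value ds \<notin> {90, 590, 950, 5950}"
      "digits_value ds \<notin> {50, 550, 5550, 55550, 555550, 5555550, 55555550, 555555550,
        5555555550, 55555555550}"
  shows "\<exists>ts\<in>{[1], [2], [4], [6], [8], [3,0], [7,0], [5,0,0], [9,0,0], [9,9,0], [5,5,9,0],
      [9,5,5,0], replicate 11 5 @ [0]}. subseq ts ds" (is "\<exists>ts\<in>?L. _")
proof (rule ccontr)
  define L where "L = ?L"
  assume "\<not> ?thesis"
  then have "\<not> (\<exists>ts\<in>L. subseq ts ds)" unfolding L_def .
  then have avoid: "\<not> subseq ts ds" if "ts \<in> L" for ts using that by blast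
  have digit: "d \<in> {0, 3, 5, 7, 9}" if d: "d \<in> set ds" for d
  proof -
    have "d < 10" using ds(3) d by blast
    then have "d \<in> {0, 1, 2, 3, 4, 5, 6, 7, 8, 9}" by auto
    moreover have "[d] \<notin> L" using avoid[of "[d]"] d by (auto simp: subseq_singleton_left)
    then have "d \<notin> {1, 2, 4, 6, 8}" unfolding L_def by auto
    ultimately show ?thesis by blast
  qed
  have "last ds \<in> set ds" using ds(1) by simp
  with digit have "last ds \<in> {0, 3, 5, 7, 9}" .
  then have "last ds = 0" using ds(4) by (elim insertE emptyE) simp_all
  then obtain ws where ds_eq: "ds = ws @ [0]" using ds(1) append_butlast_last_id by metis
  \<comment> \<open>The final 0 of \<open>ds\<close> can always match the final 0 of a forbidden
    string.\<close>
  have avoid_ws: "\<not> subseq ts ws" if "ts @ [0] \<in> L" for ts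
    using avoid[OF that] by (simp add: ds_eq)
  have single: "d \<notin> set ws" if "[d, 0] \<in> L" for d
    using avoid_ws[of "[d]"] that by (simp add: subseq_singleton_left)
  have "3 \<notin> set ws" "7 \<notin> set ws" by (rule single, simp add: L_def)+
  with digit have ws_set: "set ws \<subseteq> {0, 5, 9}" by (auto simp: ds_eq)
  obtain w us where ws: "ws = w # us" using ds(2) ds_eq by (cases ws) auto
  have "w \<noteq> 0" using ds(2) by (simp add: ds_eq ws)
  with ws_set ws have "w = 5 \<or> w = 9" by auto
  \<comment> \<open>Otherwise the final 0 would complete 500 or 900. Hence 0 occurs only at the end
    of \<open>ds\<close>.\<close>
  then have "\<not> subseq [w, 0] ws"
    using avoid_ws[of "[5, 0]"] avoid_ws[of "[9, 0]"] by (auto simp: L_def)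
  then have "0 \<notin> set us" by (auto simp: ws subseq_singleton_left)
  with ws_set \<open>w \<noteq> 0\<close> have ws59: "set ws \<subseteq> {5, 9}" by (auto simp: ws)
  show False
  proof (cases "9 \<in> set ws")
    case False
    define a where "a = length ws"
    have ws_rep: "ws = replicate a 5"
      using ws59 False by (intro replicate_eqI) (auto simp: a_def)
    have "a < 11"
    proof (rule ccontr)
      assume "\<not> a < 11"
      then have "11 \<le> a" by simp
      then have "subseq (replicate 11 5 @ [0]) ds"
        unfolding ds_eq ws_rep by (rule subseq_replicate)
      moreover have "replicate 11 5 @ [0] \<in> L" unfolding L_def by (intro insertI2 singletonI)
      ultimately show False using avoid by blast
    qed
    moreover have "a \<noteq> 0" by (simp add: a_def ws)
    ultimately have "a \<in> set [1..<11]" by simp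
    then have "a \<in> {1, 2, 3, 4, 5, 6, 7, 8, 9, 10}"
      by (simp add: upt_conv_Cons numeral_eq_Suc del: set_upt)
    then have "digits_value ds \<in> {50, 550, 5550, 55550, 555550, 5555550, 55555550, 555555550,
        5555555550, 55555555550}"
      unfolding ds_eq ws_rep digits_value_snoc digits_value_replicate
      by (elim insertE emptyE) simp_all
    with nontotient(2) show False by contradiction
  next
    case True
    then obtain xs ys where split: "ws = xs @ 9 # ys" by (auto dest: split_list)
    \<comment> \<open>Avoiding 990 allows a single 9; avoiding 5590 and 9550 then allows at most one
      5 on either side of it.\<close>
    have "\<not> subseq ([9] @ [9]) ws" using avoid_ws[of "[9, 9]"] by (simp add: L_def)
    moreover have "subseq ([9] @ [9]) (xs @ 9 # ys)" if "9 \<in> set xs"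
      using that by (intro list_emb_append_mono) (auto simp: subseq_singleton_left)
    moreover have "subseq ([] @ [9, 9]) (xs @ 9 # ys)" if "9 \<in> set ys"
      using that by (intro list_emb_append_mono) (auto simp: subseq_singleton_left)
    ultimately have "9 \<notin> set xs" "9 \<notin> set ys" by (auto simp: split)
    define a b where "a = length xs" and "b = length ys"
    have xs: "xs = replicate a 5" and ys: "ys = replicate b 5"
      using ws59 \<open>9 \<notin> set xs\<close> \<open>9 \<notin> set ys\<close>
      by (auto intro!: replicate_eqI simp: a_def b_def split)
    have "\<not> 2 \<le> a"
    proof
      assume "2 \<le> a"
      then have "subseq ((replicate 2 5 @ []) @ [9]) ((replicate a 5 @ []) @ 9 # ys)"
        by (intro list_emb_append_mono subseq_replicate) auto
      then have "subseq [5, 5, 9] ws" by (simp add: split xs numeral_2_eq_2)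
      then show False using avoid_ws[of "[5, 5, 9]"] by (simp add: L_def)
    qed
    moreover have "\<not> 2 \<le> b"
    proof
      assume "2 \<le> b"
      then have "subseq (9 # (replicate 2 5 @ [])) (9 # (replicate b 5 @ []))"
        by (intro subseq_Cons2 subseq_replicate)
      then have "subseq (9 # (replicate 2 5 @ [])) ws" unfolding split ys
        by (intro subseq_drop_many) simp
      then show False using avoid_ws[of "[9, 5, 5]"] by (simp add: L_def numeral_2_eq_2)
    qed
    ultimately have "(a = 0 \<or> a = 1) \<and> (b = 0 \<or> b = 1)" by linarith
    then have "digits_value ds \<in> {90, 590, 950, 5950}"
      unfolding ds_eq split xs ys by (elim conjE disjE) simp_all
    with nontotient(1) show False by contradiction
  qed
qed

lemma totient_value_minorised:
  assumes "n \<in> totient_values"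
  shows "\<exists>t\<in>{1, 2, 4, 6, 8, 30, 70, 500, 900, 990, 5590, 9550, 555555555550}. t \<triangleleft> n"
proof (cases "n = 1")
  case True
  then show ?thesis by (simp add: digit_subseq_def)
next
  case False
  obtain x where x: "totient x = n" "n > 0" using assms by (auto simp: totient_values_def)
  have "even (last (decimal_digits n))"
    unfolding last_decimal_digits using totient_value_even[OF assms False] by presburger
  moreover have "n \<notin> {90, 590, 950, 5950}" "n \<notin> {50, 550, 5550, 55550, 555550, 5555550,
      55555550, 555555550, 5555555550, 55555555550}"
    using not_totient_small not_totient_fives x(1) by blast+
  ultimately have "\<exists>ts\<in>{[1], [2], [4], [6], [8], [3,0], [7,0], [5,0,0], [9,0,0], [9,9,0],
      [5,5,9,0], [9,5,5,0], replicate 11 5 @ [0]}. subseq ts (decimal_digits n)"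
    by (intro minorising_digit_string)
      (simp_all only: decimal_digits_nonempty hd_decimal_digits[OF x(2)] set_decimal_digits
        digits_value_decimal_digits not_False_eq_True)
  \<comment> \<open>Written out, the list coincides with the computed digits of 555555555550, so the
    forbidden strings are the image of the candidates.\<close>
  moreover have "replicate 11 (5::nat) = [5, 5, 5, 5, 5, 5, 5, 5, 5, 5, 5]"
    by (simp add: numeral_eq_Suc)
  then have "{[1], [2], [4], [6], [8], [3,0], [7,0], [5,0,0], [9,0,0], [9,9,0], [5,5,9,0],
      [9,5,5,0], replicate 11 5 @ [0]} = decimal_digits `
      {1, 2, 4, 6, 8, 30, 70, 500, 900, 990, 5590, 9550, 555555555550}"
    by simp
  ultimately show ?thesis unfolding digit_subseq_def by (simp only: bex_simps)
qed

theorem theorem4: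
  shows "minimal_set totient_values =
    {1, 2, 4, 6, 8, 30, 70, 500, 900, 990, 5590, 9550, 555555555550}"
proof (rule minimal_set_eqI)
  fix s t :: nat
  assume "s \<in> {1, 2, 4, 6, 8, 30, 70, 500, 900, 990, 5590, 9550, 555555555550}"
    "t \<in> {1, 2, 4, 6, 8, 30, 70, 500, 900, 990, 5590, 9550, 555555555550}" "t \<triangleleft> s"
  \<comment> \<open>The antichain property is checked by evaluating all 169 pairs of digit
    strings.\<close>
  then show "t = s" unfolding digit_subseq_def by (elim insertE emptyE) simp_all
qed (fact candidates_totient_values totient_value_minorised)+

end
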